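(* Let $\mathcal{H}$ be a real Hilbert space, let $(x^k)_{k\in\mathbb{N}}$ be a sequence in $\mathcal{H}$ and let $M$ be a nonempty subset of $\mathcal{H}$. Suppose that $(x^k)_{k\in\mathbb{N}}$ is Fejér* monotone with respect to $M$. Then: (i) for all $w',w''\in\mathfrak{S}(x^k)_{k\in\mathbb{N}}$, it holds that $M\subset\left\{y\in\mathcal{H}\mid\left\langle y-\frac{w'+w''}{2},\,w'-w''\right\rangle=0\right\}$; (ii) if $\mathrm{cl}(\mathrm{aff}(M))=\mathcal{H}$, then $\mathfrak{S}(x^k)_{k\in\mathbb{N}}$ contains at most one point; (iii) the sequence $(x^k)_{k\in\mathbb{N}}$ converges strongly if there exist $x\in M$, $(\varepsilon_k)_{k\in\mathbb{N}}\in\ell_+\cap\ell^1$, and $\rho\in(0,+\infty)$ such that for all $k\in\mathbb{N}$ it holds that $\|x^{k+1}-x\|^2\le\|x^k-x\|^2-\rho\|x^{k+1}-x^k\|+\varepsilon_k$.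
   Context: $\mathbb{N}$ denotes the set of nonnegative integers. Let $\mathcal{H}$ be a real Hilbert space with inner product $\langle\cdot,\cdot\rangle$ and norm $\|\cdot\|$. A sequence $(x^k)_{k\in\mathbb{N}}\subset\mathcal{H}$ is Fejér* monotone with respect to a nonempty set $M\subset\mathcal{H}$ if for every $x\in M$ there exists $N(x)\in\mathbb{N}$ such that $\|x^{k+1}-x\|\le\|x^k-x\|$ for all $k\ge N(x)$. $\mathfrak{S}(x^k)_{k\in\mathbb{N}}$ denotes the set of strong cluster points of the sequence, i.e. the norm limits of its norm-convergent subsequences. $\mathrm{aff}(M)=\{\sum_{i=1}^p\lambda_i x_i\mid x_i\in M,\ \lambda_i\in\mathbb{R},\ \sum_{i=1}^p\lambda_i=1,\ p\in\mathbb{N}\}$ is the affine hull of $M$ and $\mathrm{cl}(\cdot)$ denotes the (norm) closure. $\ell_+$ is the set of real sequences with nonnegative entries and $\ell^1$ is the set of real sequences with finite $\ell_1$-norm (absolutely summable). *)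

theory Defs
  imports "HOL-Analysis.Analysis"
begin

(* A real Hilbert space is a type of sort {real_inner, complete_space}. *)

definition fejer_star_monotone ::
  "(nat \<Rightarrow> 'a::real_normed_vector) \<Rightarrow> 'a set \<Rightarrow> bool" where
  "fejer_star_monotone x M \<longleftrightarrow>
     (\<forall>z\<in>M. \<exists>N. \<forall>k\<ge>N. norm (x (Suc k) - z) \<le> norm (x k - z))"

definition strong_cluster_points ::
  "(nat \<Rightarrow> 'a::real_normed_vector) \<Rightarrow> 'a set" where
  "strong_cluster_points x =
     {w. \<exists>r::nat \<Rightarrow> nat. strict_mono r \<and> (\<lambda>n. x (r n)) \<longlonglongrightarrow> w}"

definition ell_plus :: "(nat \<Rightarrow> real) set" where
  "ell_plus = {e. \<forall>k. 0 \<le> e k}"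

definition ell_one :: "(nat \<Rightarrow> real) set" where
  "ell_one = {e. summable (\<lambda>k. \<bar>e k\<bar>)}"

end

theory Submission
  imports Defs
begin

text \<open>
  For each \<open>z \<in> M\<close> the distances \<open>norm (x k - z)\<close> eventually decrease, so they converge, and
  any two strong cluster points \<open>w'\<close>, \<open>w''\<close> have the same distance to \<open>z\<close>, namely this limit
  (lemma \<open>cluster_points_equidistant\<close>).
  Being equidistant from \<open>w'\<close> and \<open>w''\<close> means lying on their bisecting hyperplane
  (lemma \<open>equidistant_iff_bisector\<close>), which is (i).
  That hyperplane is closed and affine, so it contains the closed affine hull of \<open>M\<close>; if it is the
  whole space, then the normal vector \<open>w' - w''\<close> must vanish, which is (ii).
  For (iii), summing the inequality over \<open>k\<close> telescopes and shows that the path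
  \<open>x 0, x 1, \<dots>\<close> has finite length, so \<open>x\<close> is a Cauchy sequence in a complete space.
\<close>

lemma eventually_decreasing_nonneg_convergent:
  fixes f :: "nat \<Rightarrow> real"
  assumes dec: "\<And>k. k \<ge> N \<Longrightarrow> f (Suc k) \<le> f k" and nonneg: "\<And>k. 0 \<le> f k"
  shows "convergent f"
proof -
  have "decseq (\<lambda>k. f (k + N))"
    by (rule decseq_SucI) (simp add: dec)
  then obtain l where "(\<lambda>k. f (k + N)) \<longlonglongrightarrow> l"
    using decseq_convergent[of "\<lambda>k. f (k + N)" 0] nonneg by blast
  then have "f \<longlonglongrightarrow> l"
    by (rule LIMSEQ_offset)
  then show ?thesis
    by (rule convergentI)
qed

text \<open>
  The distances of the sequence to \<open>z\<close> converge as a whole, so their limit can be computed along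
  the subsequence tending to either cluster point.
\<close>

lemma cluster_points_equidistant:
  fixes x :: "nat \<Rightarrow> 'a::real_normed_vector"
  assumes "fejer_star_monotone x M" "z \<in> M"
    and "w' \<in> strong_cluster_points x" "w'' \<in> strong_cluster_points x"
  shows "norm (w' - z) = norm (w'' - z)"
proof -
  obtain N where "\<And>k. k \<ge> N \<Longrightarrow> norm (x (Suc k) - z) \<le> norm (x k - z)"
    using assms(1,2) unfolding fejer_star_monotone_def by blast
  then have "convergent (\<lambda>k. norm (x k - z))"
    by (rule eventually_decreasing_nonneg_convergent) simp_all
  then obtain l where l: "(\<lambda>k. norm (x k - z)) \<longlonglongrightarrow> l"
    by (auto simp: convergent_def)
  have "norm (w - z) = l" if w: "w \<in> strong_cluster_points x" for w
  proof -
    obtain r where r: "strict_mono r" and "(\<lambda>n. x (r n)) \<longlonglongrightarrow> w"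
      using w unfolding strong_cluster_points_def by blast
    then have "(\<lambda>n. norm (x (r n) - z)) \<longlonglongrightarrow> norm (w - z)"
      by (intro tendsto_intros)
    moreover have "(\<lambda>n. norm (x (r n) - z)) \<longlonglongrightarrow> l"
      using LIMSEQ_subseq_LIMSEQ[OF l r] by (simp add: o_def)
    ultimately show ?thesis
      by (rule LIMSEQ_unique)
  qed
  with assms(3,4) show ?thesis
    by simp
qed

text \<open>
  The left-hand side of the bisector equation is half the difference of the squared distances
  from \<open>y\<close> to \<open>w''\<close> and to \<open>w'\<close>.
\<close>

lemma equidistant_iff_bisector:
  fixes y w' w'' :: "'a::real_inner"
  shows "norm (w' - y) = norm (w'' - y) \<longleftrightarrow> inner (y - (w' + w'') /\<^sub>R 2) (w' - w'') = 0"
proof -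
  have "2 * inner (y - (w' + w'') /\<^sub>R 2) (w' - w'') = (norm (w'' - y))\<^sup>2 - (norm (w' - y))\<^sup>2"
    by (simp add: power2_norm_eq_inner inner_diff_left inner_diff_right inner_add_left
        inner_commute algebra_simps)
  moreover have "norm (w' - y) = norm (w'' - y) \<longleftrightarrow> (norm (w' - y))\<^sup>2 = (norm (w'' - y))\<^sup>2"
    by (simp add: power2_eq_iff_nonneg)
  ultimately show ?thesis
    by linarith
qed

text \<open>
  The point \<open>c + a\<close> satisfies the equation of the hyperplane through \<open>c\<close> with normal \<open>a\<close> only
  if \<open>inner a a = 0\<close>; so no proper hyperplane contains a set with dense affine hull.
\<close>

lemma normal_eq_0_if_dense_affine_hull:
  fixes a c :: "'a::real_inner"
  assumes dense: "closure (affine hull M) = UNIV"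
    and sub: "M \<subseteq> {y. inner (y - c) a = 0}"
  shows "a = 0"
proof -
  have eq: "{y. inner (y - c) a = 0} = {y. inner a y = inner a c}"
    by (metis (no_types, lifting) inner_commute inner_diff_right eq_iff_diff_eq_0)
  have "affine hull M \<subseteq> {y. inner a y = inner a c}"
    using sub unfolding eq by (rule hull_minimal) (rule affine_hyperplane)
  then have "closure (affine hull M) \<subseteq> {y. inner a y = inner a c}"
    by (rule closure_minimal) (rule closed_hyperplane)
  then have "inner a (c + a) = inner a c"
    using dense by blast
  then show ?thesis
    by (simp add: inner_add_right)
qed

text \<open>
  The distance between two points of the sequence is at most the length of the path between
  them, which is a difference of two partial sums of a convergent series.
\<close>

lemma finite_length_imp_Cauchy:
  fixes x :: "nat \<Rightarrow> 'a::metric_space"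
  assumes "summable (\<lambda>k. dist (x (Suc k)) (x k))"
  shows "Cauchy x"
proof -
  define S where "S n = (\<Sum>k<n. dist (x (Suc k)) (x k))" for n
  have "Cauchy S"
    using assms unfolding S_def summable_iff_convergent by (rule convergent_Cauchy)
  have path: "dist (x n) (x m) \<le> S n - S m" if "m \<le> n" for m n
    using that
  proof (induction n rule: dec_induct)
    case (step n)
    have "dist (x (Suc n)) (x m) \<le> dist (x (Suc n)) (x n) + dist (x n) (x m)"
      by (rule dist_triangle)
    with step.IH show ?case
      by (simp add: S_def)
  qed simp
  have "dist (x m) (x n) \<le> dist (S m) (S n)" for m n
    using path[of m n] path[of n m] linear[of m n]
    by (auto simp: dist_real_def dist_commute)
  with \<open>Cauchy S\<close> show ?thesis
    unfolding Cauchy_def by (meson le_less_trans)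
qed

text \<open>
  Here \<open>a\<close> stands for the squared distances to a point of \<open>M\<close> and \<open>d\<close> for the step lengths:
  step \<open>k\<close> spends at least \<open>\<rho> * d k\<close> from a budget that starts at \<open>a 0\<close>, is refilled by
  \<open>\<epsilon> k\<close> and never becomes negative.
\<close>

lemma summable_of_perturbed_decrease:
  fixes a d \<epsilon> :: "nat \<Rightarrow> real"
  assumes step: "\<And>k. a (Suc k) \<le> a k - \<rho> * d k + \<epsilon> k"
    and "\<rho> > 0" "summable \<epsilon>"
    and nonneg: "\<And>k. 0 \<le> a k" "\<And>k. 0 \<le> d k" "\<And>k. 0 \<le> \<epsilon> k"
  shows "summable d"
proof -
  have telescoped: "\<rho> * (\<Sum>k<n. d k) \<le> a 0 - a n + (\<Sum>k<n. \<epsilon> k)" for n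
  proof (induction n)
    case (Suc n)
    then show ?case
      using step[of n] by (simp add: distrib_left)
  qed simp
  have "(\<Sum>k<n. d k) \<le> (a 0 + suminf \<epsilon>) / \<rho>" for n
  proof -
    have "(\<Sum>k<n. \<epsilon> k) \<le> suminf \<epsilon>"
      using \<open>summable \<epsilon>\<close> nonneg(3) by (intro sum_le_suminf) auto
    then have "\<rho> * (\<Sum>k<n. d k) \<le> a 0 + suminf \<epsilon>"
      using telescoped[of n] nonneg(1)[of n] by linarith
    then show ?thesis
      using \<open>\<rho> > 0\<close> by (simp add: field_simps)
  qed
  then show ?thesis
    using nonneg(2) by (intro summableI_nonneg_bounded)
qed

theorem proposition4p6:
  fixes x :: "nat \<Rightarrow> 'a::{real_inner, complete_space}"
    and M :: "'a set"
  assumes "M \<noteq> {}"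
    and "fejer_star_monotone x M"
  shows "(\<forall>w'\<in>strong_cluster_points x. \<forall>w''\<in>strong_cluster_points x.
            M \<subseteq> {y. inner (y - (w' + w'') /\<^sub>R 2) (w' - w'') = 0})
       \<and> (closure (affine hull M) = UNIV \<longrightarrow>
            (\<forall>w'\<in>strong_cluster_points x. \<forall>w''\<in>strong_cluster_points x. w' = w''))
       \<and> ((\<exists>z\<in>M. \<exists>\<epsilon>\<in>ell_plus \<inter> ell_one. \<exists>\<rho>>0. \<forall>k.
              (norm (x (Suc k) - z))\<^sup>2
                \<le> (norm (x k - z))\<^sup>2 - \<rho> * norm (x (Suc k) - x k) + \<epsilon> k)
            \<longrightarrow> convergent x)"
proof -
  have bisector: "M \<subseteq> {y. inner (y - (w' + w'') /\<^sub>R 2) (w' - w'') = 0}"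
    if "w' \<in> strong_cluster_points x" "w'' \<in> strong_cluster_points x" for w' w''
    using cluster_points_equidistant[OF assms(2) _ that] equidistant_iff_bisector by blast
  have unique: "w' = w''"
    if "closure (affine hull M) = UNIV"
      "w' \<in> strong_cluster_points x" "w'' \<in> strong_cluster_points x" for w' w''
    using normal_eq_0_if_dense_affine_hull[OF that(1) bisector[OF that(2,3)]] by simp
  have strong: "convergent x"
    if \<epsilon>: "\<epsilon> \<in> ell_plus \<inter> ell_one" and \<rho>: "\<rho> > 0"
      and step: "\<forall>k. (norm (x (Suc k) - z))\<^sup>2
        \<le> (norm (x k - z))\<^sup>2 - \<rho> * norm (x (Suc k) - x k) + \<epsilon> k" for z \<epsilon> \<rho>
  proof -
    have nonneg: "0 \<le> \<epsilon> k" for k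
      using \<epsilon> by (simp add: ell_plus_def)
    then have "summable \<epsilon>"
      using \<epsilon> by (simp add: ell_one_def)
    then have "summable (\<lambda>k. norm (x (Suc k) - x k))"
      using nonneg
      by (intro summable_of_perturbed_decrease
          [where a = "\<lambda>k. (norm (x k - z))\<^sup>2", OF step[rule_format] \<rho> \<open>summable \<epsilon>\<close>]) simp_all
    then have "Cauchy x"
      by (intro finite_length_imp_Cauchy) (simp add: dist_norm)
    then show ?thesis
      by (rule Cauchy_convergent)
  qed
  show ?thesis
  proof (intro conjI ballI impI)
    assume "\<exists>z\<in>M. \<exists>\<epsilon>\<in>ell_plus \<inter> ell_one. \<exists>\<rho>>0. \<forall>k.
      (norm (x (Suc k) - z))\<^sup>2
        \<le> (norm (x k - z))\<^sup>2 - \<rho> * norm (x (Suc k) - x k) + \<epsilon> k"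
    then show "convergent x"
      by (elim bexE exE conjE) (rule strong)
  qed (fact bisector unique)+
qed

end
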